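(* Let $n=m\ge 1$ and $\mathbf a=\mathbf b=\frac1n\mathbf 1_n$. Let $\mathbf L=(L_{ijkl})$ be a symmetric real 4D tensor with all indices in $\{1,\dots,n\}$, and suppose that $\mathbf L$ is conditionally negative semi-definite (CND) with respect to $\overline{\Pi}=\Pi(\mathbf a,\mathbf b)-\Pi(\mathbf a,\mathbf b)$. Then there exists an optimal solution of $\min_{\mathbf P\in\Pi(\mathbf a,\mathbf b)}\langle\mathbf L\otimes\mathbf P,\mathbf P\rangle$ that is also a solution of $\min_{\mathbf P\in\operatorname{Perm}(n)}\langle\mathbf L\otimes\mathbf P,\mathbf P\rangle$, and $$\min_{\mathbf P\in\operatorname{Perm}(n)}\langle\mathbf L\otimes\mathbf P,\mathbf P\rangle=\min_{\mathbf P\in\Pi(\mathbf a,\mathbf b)}\langle\mathbf L\otimes\mathbf P,\mathbf P\rangle .$$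
   Context: $\Pi(\mathbf a,\mathbf b)=\{\mathbf P\in\mathbb R_+^{n\times m}:\mathbf P\mathbf 1_m=\mathbf a,\ \mathbf P^\top\mathbf 1_n=\mathbf b\}$, where $\mathbf 1_n$ is the all-ones vector of $\mathbb R^n$. $\operatorname{Perm}(n)$ is the set of matrices $\mathbf P\in\mathbb R^{n\times n}$ for which there is a permutation $\sigma$ of $\{1,\dots,n\}$ with $P_{ij}=\frac1n$ if $j=\sigma(i)$ and $P_{ij}=0$ otherwise. $\langle\mathbf A,\mathbf B\rangle=\sum_{ij}A_{ij}B_{ij}$. $\mathbf L\otimes\mathbf P$ is the matrix with $(k,l)$ entry $\sum_{ij}L_{ijkl}P_{ij}$, so $\langle\mathbf L\otimes\mathbf P,\mathbf P\rangle=\sum_{ijkl}L_{ijkl}P_{ij}P_{kl}$. $\mathbf L$ is symmetric if $L_{ijkl}=L_{klij}$ for all $i,j,k,l$. A symmetric tensor $\mathbf L$ is CND with respect to $\overline{\Pi}=\{\mathbf P_1-\mathbf P_2:\mathbf P_1,\mathbf P_2\in\Pi(\mathbf a,\mathbf b)\}$ if $\langle\mathbf L\otimes\mathbf Q,\mathbf Q\rangle\le 0$ for all $\mathbf Q\in\overline{\Pi}$. *)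

theory Defs
  imports "HOL-Analysis.Analysis"
begin

text \<open>
  An \<open>n \<times> m\<close> real matrix is an element of \<^typ>\<open>real ^ 'm ^ 'n\<close>, where \<open>n = CARD('n)\<close> and
  \<open>m = CARD('m)\<close>.  The Frobenius inner product is then the library inner product \<open>(\<bullet>)\<close>, and
  \<open>1 :: real ^ 'n\<close> is the all-ones vector.
\<close>

type_synonym ('n, 'm) tensor = "real ^ 'm ^ 'n ^ 'm ^ 'n"

definition couplings :: "real ^ 'n \<Rightarrow> real ^ 'm \<Rightarrow> (real ^ 'm ^ 'n) set" where
  "couplings a b =
     {P. (\<forall>i j. 0 \<le> P $ i $ j) \<and> P *v 1 = a \<and> transpose P *v 1 = b}"

definition coupling_differences :: "real ^ 'n \<Rightarrow> real ^ 'm \<Rightarrow> (real ^ 'm ^ 'n) set" where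
  "coupling_differences a b = {P1 - P2 | P1 P2. P1 \<in> couplings a b \<and> P2 \<in> couplings a b}"

definition uniform_vec :: "real ^ 'n" where
  "uniform_vec = (1 / real CARD('n)) *\<^sub>R 1"

text \<open>Permutation matrices are scaled by \<open>1/n\<close> so that they have uniform marginals.\<close>

definition Perm :: "(real ^ 'n ^ 'n) set" where
  "Perm = {P. \<exists>\<sigma>. \<sigma> permutes UNIV \<and>
     (\<forall>i j. P $ i $ j = (if j = \<sigma> i then 1 / real CARD('n) else 0))}"

definition tensor_mult :: "('n::finite, 'm::finite) tensor \<Rightarrow> real ^ 'm ^ 'n \<Rightarrow> real ^ 'm ^ 'n" where
  "tensor_mult L P = (\<chi> k l. \<Sum>i\<in>UNIV. \<Sum>j\<in>UNIV. L $ i $ j $ k $ l * P $ i $ j)"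

definition symmetric_tensor :: "('n::finite, 'm::finite) tensor \<Rightarrow> bool" where
  "symmetric_tensor L \<longleftrightarrow> (\<forall>i j k l. L $ i $ j $ k $ l = L $ k $ l $ i $ j)"

definition cnd_wrt :: "(real ^ 'm ^ 'n) set \<Rightarrow> ('n::finite, 'm::finite) tensor \<Rightarrow> bool" where
  "cnd_wrt S L \<longleftrightarrow> (\<forall>Q\<in>S. tensor_mult L Q \<bullet> Q \<le> 0)"

end

theory Submission
  imports Defs
begin

text \<open>
  A coupling \<open>P\<close> that is not a scaled permutation matrix has an entry strictly between \<open>0\<close> and
  \<open>1/n\<close>, and every row or column meeting the set \<open>F\<close> of such entries meets it twice. If \<open>F\<close> meets
  \<open>r\<close> rows and \<open>c\<close> columns, then \<open>card F \<ge> r + c\<close>, whereas the row and column sums of a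
  matrix supported on \<open>F\<close> satisfy only \<open>r + c - 1\<close> independent conditions; hence there is a nonzero
  direction \<open>D\<close> supported on \<open>F\<close> with vanishing marginals. The objective is concave along \<open>D\<close>, so
  for a suitable sign of \<open>D\<close> it does not increase when one moves from \<open>P\<close> along \<open>D\<close> until an entry
  of \<open>P\<close> vanishes. Induction on the size of the support leads to a scaled permutation matrix.
\<close>

section \<open>Nonzero matrices with zero marginals on a set of cells\<close>

lemma two_card_image_le:
  assumes "finite F" and "\<And>x. x \<in> F \<Longrightarrow> \<exists>y\<in>F. f y = f x \<and> y \<noteq> x"
  shows "2 * card (f ` F) \<le> card F"
proof -
  have "2 \<le> card {x\<in>F. f x = z}" if "z \<in> f ` F" for z
  proof -
    from that obtain x where x: "x \<in> F" "f x = z" by blast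
    with assms(2) obtain y where "y \<in> F" "f y = z" "y \<noteq> x" by metis
    with x have "{x, y} \<subseteq> {x\<in>F. f x = z}" by auto
    then have "card {x, y} \<le> card {x\<in>F. f x = z}"
      using assms(1) by (intro card_mono) auto
    with \<open>y \<noteq> x\<close> show ?thesis by auto
  qed
  \<comment> \<open>Double counting: the fibres over the image partition \<open>F\<close>, and each
    has at least two elements.\<close>
  then have "(\<Sum>z\<in>f ` F. 2) \<le> (\<Sum>z\<in>f ` F. card {x\<in>F. f x = z})"
    by (rule sum_mono)
  also have "\<dots> = card F"
    using sum.group[OF assms(1) finite_imageI[OF assms(1)] order_refl, where h = "\<lambda>_. 1::nat"]
    by simp
  finally show ?thesis by simp
qed

lemma matrix_vector_mult_one_nth:
  fixes P :: "real ^ 'm ^ 'n"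
  shows "(P *v 1) $ i = (\<Sum>j\<in>UNIV. P $ i $ j)"
  by (simp add: matrix_vector_mult_def)

text \<open>A dimension count: \<open>e\<close> sends a cell to the pair of marginals of the unit
  matrix at that cell, so a linear dependence among the vectors \<open>e x\<close> with
  \<open>x\<close> in \<open>F\<close> is a matrix of the desired kind.\<close>

lemma exists_zero_marginal_matrix:
  fixes F :: "('n::finite \<times> 'm::finite) set"
  assumes "F \<noteq> {}"
    and rows: "\<And>x. x \<in> F \<Longrightarrow> \<exists>y\<in>F. fst y = fst x \<and> y \<noteq> x"
    and cols: "\<And>x. x \<in> F \<Longrightarrow> \<exists>y\<in>F. snd y = snd x \<and> y \<noteq> x"
  obtains D :: "real ^ 'm ^ 'n"
  where "D \<noteq> 0" "\<And>i j. (i, j) \<notin> F \<Longrightarrow> D $ i $ j = 0" "D *v 1 = 0" "transpose D *v 1 = 0"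
proof -
  define e :: "'n \<times> 'm \<Rightarrow> (real ^ 'n) \<times> (real ^ 'm)"
    where "e = (\<lambda>(i, j). (axis i 1, axis j 1))"
  have inj: "inj_on e A" for A
    by (auto simp: inj_on_def e_def axis_eq_axis)
  obtain c where c: "c \<in> snd ` F" using assms(1) by blast
  \<comment> \<open>Every \<open>e (i, j)\<close> is \<open>e (i, c)\<close> corrected by a
    difference of column vectors. Fixing one reference column \<open>c\<close> saves one vector,
    since both marginals of a matrix have the same total. The cells \<open>(i, c)\<close> need not
    lie in \<open>F\<close>.\<close>
  define B where "B = (\<lambda>i. e (i, c)) ` (fst ` F) \<union> (\<lambda>j. (0, axis j 1 - axis c 1)) ` (snd ` F - {c})"
  have "e ` F \<subseteq> span B"
  proof (rule image_subsetI)
    fix x assume "x \<in> F"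
    moreover obtain i j where x: "x = (i, j)" by fastforce
    ultimately have "i \<in> fst ` F" "j \<in> snd ` F" by force+
    then have "e (i, c) \<in> span B" by (auto simp: B_def intro!: span_base)
    moreover have "(0, axis j 1 - axis c 1) \<in> span B"
    proof (cases "j = c")
      case True
      then show ?thesis by (simp flip: zero_prod_def add: span_zero)
    next
      case False
      with \<open>j \<in> snd ` F\<close> show ?thesis by (auto simp: B_def intro!: span_base)
    qed
    ultimately have "e (i, c) + (0, axis j 1 - axis c 1) \<in> span B" by (rule span_add)
    then show "e x \<in> span B" by (simp add: e_def x)
  qed
  moreover have "finite B" by (simp add: B_def)
  moreover have "card B < card (e ` F)"
  proof -
    have "card B \<le> card (fst ` F) + card (snd ` F - {c})"
      unfolding B_def by (intro order_trans[OF card_Un_le] add_mono card_image_le) auto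
    also have "\<dots> < card (fst ` F) + card (snd ` F)"
      using c by (intro add_strict_left_mono card_Diff1_less) auto
    also have "\<dots> \<le> card F"
      using two_card_image_le[of F fst, OF _ rows] two_card_image_le[of F snd, OF _ cols] by auto
    finally show ?thesis by (simp add: card_image inj)
  qed
  ultimately have "dependent (e ` F)"
    using independent_span_bound[of B "e ` F"] by auto
  then obtain u where u: "\<exists>v\<in>e ` F. u v \<noteq> 0" "(\<Sum>v\<in>e ` F. u v *\<^sub>R v) = 0"
    using dependent_finite[of "e ` F"] by auto
  \<comment> \<open>With the coefficients read as entries, the vanishing combination of the
    \<open>e x\<close> is the pair of marginals of \<open>D\<close>.\<close>
  define D :: "real ^ 'm ^ 'n" where "D = (\<chi> i j. if (i, j) \<in> F then u (e (i, j)) else 0)"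
  have "0 = (\<Sum>x\<in>F. u (e x) *\<^sub>R e x)"
    using u(2) by (simp add: sum.reindex inj)
  also have "\<dots> = (\<Sum>x\<in>UNIV. D $ fst x $ snd x *\<^sub>R e x)"
    by (rule sum.mono_neutral_cong_left) (auto simp: D_def)
  also have "\<dots> = (\<Sum>i\<in>UNIV. \<Sum>j\<in>UNIV. D $ i $ j *\<^sub>R e (i, j))"
    by (simp add: sum.cartesian_product case_prod_unfold)
  finally have *: "(\<Sum>i\<in>UNIV. \<Sum>j\<in>UNIV. D $ i $ j *\<^sub>R e (i, j)) = 0" ..
  \<comment> \<open>Pulls the condition on the row out of the inner sum, so that the outer sum
    collapses to row \<open>k\<close>.\<close>
  have "(\<Sum>j\<in>UNIV. if i = k then D $ k $ j else 0) = (if i = k then \<Sum>j\<in>UNIV. D $ k $ j else 0)"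
    for i k by simp
  then have "D *v 1 = fst (\<Sum>i\<in>UNIV. \<Sum>j\<in>UNIV. D $ i $ j *\<^sub>R e (i, j))"
    by (simp add: vec_eq_iff matrix_vector_mult_one_nth fst_sum e_def axis_def
        if_distrib[of "(*) _"] cong: if_cong)
  moreover have "transpose D *v 1 = snd (\<Sum>i\<in>UNIV. \<Sum>j\<in>UNIV. D $ i $ j *\<^sub>R e (i, j))"
    by (simp add: vec_eq_iff matrix_vector_mult_one_nth transpose_def snd_sum e_def axis_def
        if_distrib[of "(*) _"] del: transpose_matrix_vector cong: if_cong)
  moreover have "D \<noteq> 0"
    using u(1) by (auto simp: D_def vec_eq_iff)
  ultimately show ?thesis
    using that[of D] * by (simp add: D_def)
qed

text \<open>A ratio test. As \<open>D\<close> is nonzero with zero row sums, it has a negative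
  entry; the smallest ratio over such entries is the longest step that keeps all entries
  nonnegative. It is positive because \<open>P\<close> is nonzero wherever \<open>D\<close> is, and
  the entry attaining it drops to zero while no new support appears.\<close>

lemma exists_step_to_boundary:
  fixes P D :: "real ^ 'm ^ 'n"
  assumes P: "P \<in> couplings a b" and D: "D \<noteq> 0" "D *v 1 = 0" "transpose D *v 1 = 0"
    and supp: "\<And>i j. D $ i $ j \<noteq> 0 \<Longrightarrow> P $ i $ j \<noteq> 0"
  obtains t where "t > 0" "P + t *\<^sub>R D \<in> couplings a b"
    "{(i, j). (P + t *\<^sub>R D) $ i $ j \<noteq> 0} \<subset> {(i, j). P $ i $ j \<noteq> 0}"
proof -
  define N where "N = {(i, j). D $ i $ j < 0}"
  have P0: "P $ i $ j \<ge> 0" for i j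
    using P by (simp add: couplings_def)
  have "N \<noteq> {}"
  proof
    assume "N = {}"
    then have nonneg: "D $ i $ j \<ge> 0" for i j
      by (auto simp: N_def not_less)
    have "(\<Sum>j\<in>UNIV. D $ i $ j) = 0" for i
      using D(2) by (metis matrix_vector_mult_one_nth zero_index)
    then have "D $ i $ j = 0" for i j
      using nonneg sum_nonneg_eq_0_iff[of UNIV "\<lambda>j. D $ i $ j"] by simp
    with D(1) show False by (simp add: vec_eq_iff)
  qed
  define g where "g = (\<lambda>(i, j). P $ i $ j / - D $ i $ j)"
  define t where "t = Min (g ` N)"
  have "t \<in> g ` N"
    unfolding t_def using \<open>N \<noteq> {}\<close> by (intro Min_in) auto
  then obtain r s where rs: "D $ r $ s < 0" "t = P $ r $ s / - D $ r $ s"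
    by (auto simp: N_def g_def)
  have "P $ r $ s > 0"
    using supp[of r s] P0[of r s] rs(1) by simp
  with rs have t: "t > 0" by (simp add: divide_pos_neg)
  have nonneg: "P $ i $ j + t * D $ i $ j \<ge> 0" for i j
  proof (cases "D $ i $ j < 0")
    case True
    then have "t \<le> g (i, j)"
      unfolding t_def by (intro Min_le) (auto simp: N_def)
    with True show ?thesis by (simp add: g_def field_simps)
  next
    case False
    with t P0 show ?thesis by simp
  qed
  have "P + t *\<^sub>R D \<in> couplings a b"
  proof -
    have "(P + t *\<^sub>R D) *v 1 = a"
      using P D(2) by (simp add: couplings_def matrix_vector_mult_add_rdistrib
          scaleR_matrix_vector_assoc[symmetric])
    moreover have "transpose (P + t *\<^sub>R D) = transpose P + t *\<^sub>R transpose D"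
      by (simp add: transpose_def vec_eq_iff)
    then have "transpose (P + t *\<^sub>R D) *v 1 = b"
      using P D(3) by (simp add: couplings_def matrix_vector_mult_add_rdistrib
          scaleR_matrix_vector_assoc[symmetric])
    ultimately show ?thesis
      using nonneg by (simp add: couplings_def)
  qed
  moreover have "{(i, j). (P + t *\<^sub>R D) $ i $ j \<noteq> 0} \<subset> {(i, j). P $ i $ j \<noteq> 0}"
  proof
    show "{(i, j). (P + t *\<^sub>R D) $ i $ j \<noteq> 0} \<subseteq> {(i, j). P $ i $ j \<noteq> 0}"
      using supp by fastforce
    have "(P + t *\<^sub>R D) $ r $ s = 0"
      using rs by simp
    with \<open>P $ r $ s > 0\<close>
    show "{(i, j). (P + t *\<^sub>R D) $ i $ j \<noteq> 0} \<noteq> {(i, j). P $ i $ j \<noteq> 0}"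
      by (metis (mono_tags, lifting) case_prodI mem_Collect_eq case_prodD less_irrefl)
  qed
  ultimately show ?thesis using that t by blast
qed

section \<open>Uniform couplings and scaled permutation matrices\<close>

lemma exists_other_fractional:
  fixes x :: "'a::finite \<Rightarrow> real"
  assumes "\<And>i. x i \<ge> 0" and "sum x UNIV = c" and "0 < x i" "x i < c"
  shows "\<exists>j. j \<noteq> i \<and> 0 < x j \<and> x j < c"
proof -
  have s: "sum x (UNIV - {i}) = c - x i"
    using assms(2) by (simp add: sum_diff1)
  then have "sum x (UNIV - {i}) > 0" using assms(4) by simp
  then obtain j where j: "j \<in> UNIV - {i}" "x j > 0"
    by (meson not_less sum_nonpos)
  \<comment> \<open>This bound, with \<open>x i\<close> positive, keeps \<open>x j\<close> strictly
    below \<open>c\<close>.\<close>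
  then have "x j \<le> c - x i"
    using member_le_sum[of j "UNIV - {i}" x] assms(1) s by auto
  with j assms(3) show ?thesis by auto
qed

lemma ex1_eq_of_sum_eq:
  fixes x :: "'a::finite \<Rightarrow> real"
  assumes "\<And>i. x i = 0 \<or> x i = c" and "sum x UNIV = c" and "c > 0"
  shows "\<exists>!i. x i = c"
proof -
  have "c = (\<Sum>i\<in>UNIV. if x i = c then c else 0)"
    unfolding assms(2)[symmetric] by (rule sum.cong) (use assms in auto)
  also have "\<dots> = real (card {i. x i = c}) * c"
    by (simp add: sum.If_cases)
  finally have "card {i. x i = c} = 1" using assms(3) by simp
  then obtain i where "{i. x i = c} = {i}" by (rule card_1_singletonE)
  then show ?thesis by (intro ex1I[of _ i]) auto
qed

lemma uniform_vec_nth: "uniform_vec $ (i :: 'n::finite) = 1 / real CARD('n)"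
  by (simp add: uniform_vec_def)

lemma uniform_couplings_iff:
  fixes P :: "real ^ 'n ^ 'n"
  shows "P \<in> couplings uniform_vec uniform_vec \<longleftrightarrow> (\<forall>i j. 0 \<le> P $ i $ j)
    \<and> (\<forall>i. (\<Sum>j\<in>UNIV. P $ i $ j) = 1 / real CARD('n))
    \<and> (\<forall>j. (\<Sum>i\<in>UNIV. P $ i $ j) = 1 / real CARD('n))"
  by (simp add: couplings_def vec_eq_iff matrix_vector_mult_one_nth
      transpose_def uniform_vec_nth del: transpose_matrix_vector)

lemma Perm_subset_couplings: "(Perm :: (real ^ 'n ^ 'n) set) \<subseteq> couplings uniform_vec uniform_vec"
proof
  fix P :: "real ^ 'n ^ 'n" assume "P \<in> Perm"
  then obtain \<sigma> where \<sigma>: "\<sigma> permutes UNIV"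
    "\<And>i j. P $ i $ j = (if j = \<sigma> i then 1 / real CARD('n) else 0)"
    by (auto simp: Perm_def)
  \<comment> \<open>Solving for the row index leaves a single nonzero term in each column
    sum.\<close>
  have "j = \<sigma> i \<longleftrightarrow> i = inv \<sigma> j" for i j
    using \<sigma>(1) by (metis permutes_inverses)
  with \<sigma>(2) have "P $ i $ j = (if i = inv \<sigma> j then 1 / real CARD('n) else 0)" for i j
    by simp
  then have "(\<Sum>i\<in>UNIV. P $ i $ j) = 1 / real CARD('n)" for j
    by (simp del: of_nat_eq_0_iff)
  with \<sigma>(2) show "P \<in> couplings uniform_vec uniform_vec"
    by (simp add: uniform_couplings_iff)
qed

text \<open>Together with nonemptiness, this ensures that the objective attains its minimum on
  \<open>Perm\<close>.\<close>

lemma finite_Perm: "finite (Perm :: (real ^ 'n ^ 'n) set)"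
proof (rule finite_subset)
  show "(Perm :: (real ^ 'n ^ 'n) set)
    \<subseteq> range (\<lambda>\<sigma>. \<chi> i j. if j = \<sigma> i then 1 / real CARD('n) else 0)"
  proof
    fix P :: "real ^ 'n ^ 'n" assume "P \<in> Perm"
    then obtain \<sigma> where "\<And>i j. P $ i $ j = (if j = \<sigma> i then 1 / real CARD('n) else 0)"
      by (auto simp: Perm_def)
    then have "P = (\<chi> i j. if j = \<sigma> i then 1 / real CARD('n) else 0)"
      by (simp add: vec_eq_iff)
    then show "P \<in> range (\<lambda>\<sigma>. \<chi> i j. if j = \<sigma> i then 1 / real CARD('n) else 0)"
      by blast
  qed
qed simp

lemma Perm_nonempty: "(Perm :: (real ^ 'n ^ 'n) set) \<noteq> {}"
proof -
  have "(\<chi> i j. if j = id i then 1 / real CARD('n) else 0) \<in> (Perm :: (real ^ 'n ^ 'n) set)"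
    unfolding Perm_def using permutes_id[of UNIV] by (intro CollectI exI[of _ id]) auto
  then show ?thesis by blast
qed

text \<open>Each row sum forces exactly one nonzero entry per row, which defines \<sigma>.
  Uniqueness within columns makes \<sigma> injective, hence bijective by finiteness.\<close>

lemma uniform_coupling_in_Perm:
  fixes P :: "real ^ 'n ^ 'n"
  assumes P: "P \<in> couplings uniform_vec uniform_vec"
    and "\<And>i j. P $ i $ j = 0 \<or> P $ i $ j = 1 / real CARD('n)"
  shows "P \<in> Perm"
proof -
  have pos: "1 / real CARD('n) > 0" by simp
  have row: "\<exists>!j. P $ i $ j = 1 / real CARD('n)" for i
    using assms(2) P pos by (intro ex1_eq_of_sum_eq) (simp_all add: uniform_couplings_iff)
  have col: "\<exists>!i. P $ i $ j = 1 / real CARD('n)" for j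
    using assms(2) P pos by (intro ex1_eq_of_sum_eq) (simp_all add: uniform_couplings_iff)
  obtain \<sigma> where \<sigma>: "\<And>i j. P $ i $ j = 1 / real CARD('n) \<longleftrightarrow> j = \<sigma> i"
    using row by metis
  have "inj \<sigma>"
    using col by (metis (no_types, lifting) \<sigma> injI)
  then have "\<sigma> permutes UNIV"
    by (intro bij_imp_permutes) (auto simp: bij_betw_def dest: finite_UNIV_inj_surj[OF finite])
  moreover have "P $ i $ j = (if j = \<sigma> i then 1 / real CARD('n) else 0)" for i j
    using assms(2) \<sigma> by metis
  ultimately show ?thesis by (auto simp: Perm_def)
qed

text \<open>Entries never exceed \<open>1/n\<close>, so outside \<open>Perm\<close> some entry is
  strictly fractional. A fractional entry cannot be alone in its row or column, because the
  remaining mass there is again strictly between 0 and \<open>1/n\<close>.\<close>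

lemma exists_support_preserving_direction:
  fixes P :: "real ^ 'n ^ 'n"
  assumes P: "P \<in> couplings uniform_vec uniform_vec" and "P \<notin> Perm"
  obtains D :: "real ^ 'n ^ 'n"
  where "D \<noteq> 0" "\<And>i j. D $ i $ j \<noteq> 0 \<Longrightarrow> P $ i $ j \<noteq> 0" "D *v 1 = 0" "transpose D *v 1 = 0"
proof -
  let ?c = "1 / real CARD('n)"
  define F where "F = {(i, j). 0 < P $ i $ j \<and> P $ i $ j < ?c}"
  have nonneg: "P $ i $ j \<ge> 0" and row: "(\<Sum>j\<in>UNIV. P $ i $ j) = ?c"
    and col: "(\<Sum>i\<in>UNIV. P $ i $ j) = ?c" for i j
    using P by (simp_all add: uniform_couplings_iff)
  have le: "P $ i $ j \<le> ?c" for i j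
    using member_le_sum[of j UNIV "\<lambda>j. P $ i $ j"] nonneg row[of i] by simp
  have "F \<noteq> {}"
  proof
    assume "F = {}"
    then have "P $ i $ j = 0 \<or> P $ i $ j = ?c" for i j
      using nonneg[of i j] le[of i j] by (auto simp: F_def order.order_iff_strict)
    then show False
      using uniform_coupling_in_Perm[OF P] assms(2) by blast
  qed
  moreover have "\<exists>y\<in>F. fst y = fst x \<and> y \<noteq> x" if "x \<in> F" for x
  proof -
    obtain i j where x: "x = (i, j)" by fastforce
    with that have "0 < P $ i $ j" "P $ i $ j < ?c" by (auto simp: F_def)
    then obtain j' where "j' \<noteq> j" "0 < P $ i $ j'" "P $ i $ j' < ?c"
      using exists_other_fractional[of "\<lambda>j. P $ i $ j", OF nonneg row] by blast
    with x show ?thesis by (intro bexI[of _ "(i, j')"]) (auto simp: F_def)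
  qed
  moreover have "\<exists>y\<in>F. snd y = snd x \<and> y \<noteq> x" if "x \<in> F" for x
  proof -
    obtain i j where x: "x = (i, j)" by fastforce
    with that have "0 < P $ i $ j" "P $ i $ j < ?c" by (auto simp: F_def)
    then obtain i' where "i' \<noteq> i" "0 < P $ i' $ j" "P $ i' $ j < ?c"
      using exists_other_fractional[of "\<lambda>i. P $ i $ j", OF nonneg col] by blast
    with x show ?thesis by (intro bexI[of _ "(i', j)"]) (auto simp: F_def)
  qed
  ultimately obtain D :: "real ^ 'n ^ 'n"
    where D: "D \<noteq> 0" "\<And>i j. (i, j) \<notin> F \<Longrightarrow> D $ i $ j = 0" "D *v 1 = 0" "transpose D *v 1 = 0"
    using exists_zero_marginal_matrix[of F] by blast
  show ?thesis
    using that[of D] D by (force simp: F_def)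
qed

section \<open>Descent of the objective to a permutation matrix\<close>

lemma tensor_mult_add: "tensor_mult L (P + Q) = tensor_mult L P + tensor_mult L Q"
  by (simp add: tensor_mult_def vec_eq_iff algebra_simps sum.distrib)

lemma tensor_mult_scaleR: "tensor_mult L (t *\<^sub>R P) = t *\<^sub>R tensor_mult L P"
  by (simp add: tensor_mult_def vec_eq_iff algebra_simps sum_distrib_left)

lemma exists_Perm_tensor_le:
  fixes L :: "('n::finite, 'n) tensor"
  assumes cnd: "cnd_wrt (coupling_differences uniform_vec uniform_vec) L"
    and "P \<in> couplings uniform_vec uniform_vec"
  shows "\<exists>Q\<in>Perm. tensor_mult L Q \<bullet> Q \<le> tensor_mult L P \<bullet> P"
  using assms(2)
proof (induction "card {(i, j). P $ i $ j \<noteq> 0}" arbitrary: P rule: less_induct)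
  case less
  show ?case
  proof (cases "P \<in> Perm")
    case False
    obtain D0 :: "real ^ 'n ^ 'n" where D0: "D0 \<noteq> 0"
      "\<And>i j. D0 $ i $ j \<noteq> 0 \<Longrightarrow> P $ i $ j \<noteq> 0" "D0 *v 1 = 0" "transpose D0 *v 1 = 0"
      using exists_support_preserving_direction[OF less.prems False] by blast
    \<comment> \<open>The part linear in \<open>E\<close> of the objective at \<open>P + E\<close>.
      The only other change is the quadratic term
      \<open>tensor_mult L E \<bullet> E\<close>.\<close>
    define slope where "slope E = tensor_mult L P \<bullet> E + tensor_mult L E \<bullet> P" for E
    have slope_scaleR: "slope (s *\<^sub>R E) = s * slope E" for s E
      by (simp add: slope_def tensor_mult_scaleR algebra_simps)
    \<comment> \<open>By linearity one of \<open>D0\<close> and \<open>- D0\<close> has nonpositive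
      slope; changing the sign affects neither support nor zero marginals.\<close>
    define s :: real where "s = (if slope D0 \<le> 0 then 1 else -1)"
    define D where "D = s *\<^sub>R D0"
    have "s \<noteq> 0" by (simp add: s_def)
    have "D \<noteq> 0" "D *v 1 = 0"
      using D0 \<open>s \<noteq> 0\<close> by (auto simp: D_def scaleR_matrix_vector_assoc[symmetric])
    moreover have "transpose D *v 1 = 0"
    proof -
      have "transpose D = s *\<^sub>R transpose D0"
        by (simp add: D_def transpose_def vec_eq_iff)
      then show ?thesis
        using D0(4) by (simp add: scaleR_matrix_vector_assoc[symmetric])
    qed
    moreover have "P $ i $ j \<noteq> 0" if "D $ i $ j \<noteq> 0" for i j
      using that D0(2)[of i j] by (simp add: D_def)
    ultimately obtain t where t: "t > 0" "P + t *\<^sub>R D \<in> couplings uniform_vec uniform_vec"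
      "{(i, j). (P + t *\<^sub>R D) $ i $ j \<noteq> 0} \<subset> {(i, j). P $ i $ j \<noteq> 0}"
      using exists_step_to_boundary[OF less.prems, of D] by blast
    have "slope D \<le> 0"
      by (simp add: D_def slope_scaleR s_def)
    then have "slope (t *\<^sub>R D) \<le> 0"
      using t(1) by (simp add: slope_scaleR mult_nonneg_nonpos)
    \<comment> \<open>The step itself is a difference of two couplings, so the CND hypothesis bounds
      its quadratic term.\<close>
    moreover have "(P + t *\<^sub>R D) - P \<in> coupling_differences uniform_vec uniform_vec"
      using t(2) less.prems unfolding coupling_differences_def by blast
    then have "tensor_mult L (t *\<^sub>R D) \<bullet> (t *\<^sub>R D) \<le> 0"
      using cnd unfolding cnd_wrt_def by (metis add_diff_cancel_left')
    ultimately have "tensor_mult L (P + t *\<^sub>R D) \<bullet> (P + t *\<^sub>R D) \<le> tensor_mult L P \<bullet> P"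
      by (simp only: tensor_mult_add slope_def inner_add_left inner_add_right)
    moreover have "\<exists>Q\<in>Perm. tensor_mult L Q \<bullet> Q \<le> tensor_mult L (P + t *\<^sub>R D) \<bullet> (P + t *\<^sub>R D)"
      using t(2,3) by (intro less.hyps psubset_card_mono) auto
    ultimately show ?thesis by (meson order_trans)
  qed auto
qed

theorem corollary3:
  fixes L :: "('n::finite, 'n) tensor" and a b :: "real ^ 'n"
  assumes "a = uniform_vec" and "b = uniform_vec"
    and "symmetric_tensor L"
    and "cnd_wrt (coupling_differences a b) L"
  shows "(\<exists>P. is_arg_min (\<lambda>P. tensor_mult L P \<bullet> P) (\<lambda>P. P \<in> couplings a b) P \<and>
              is_arg_min (\<lambda>P. tensor_mult L P \<bullet> P) (\<lambda>P. P \<in> Perm) P)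
    \<and> (INF P\<in>Perm. tensor_mult L P \<bullet> P) = (INF P\<in>couplings a b. tensor_mult L P \<bullet> P)"
proof -
  let ?f = "\<lambda>P. tensor_mult L P \<bullet> P"
  obtain P where P: "is_arg_min ?f (\<lambda>P. P \<in> Perm) P"
    using ex_is_arg_min_if_finite[OF finite_Perm Perm_nonempty, of ?f] by blast
  then have PPerm: "P \<in> Perm" and min_Perm: "\<And>Q. Q \<in> Perm \<Longrightarrow> ?f P \<le> ?f Q"
    by (auto simp: is_arg_min_linorder)
  have PC: "P \<in> couplings a b"
    using PPerm Perm_subset_couplings assms(1,2) by blast
  \<comment> \<open>Each coupling is dominated by some element of \<open>Perm\<close>, which is
    dominated by \<open>P\<close>.\<close>
  have min_C: "?f P \<le> ?f Q" if "Q \<in> couplings a b" for Q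
    using exists_Perm_tensor_le[of L Q] assms(1,2,4) that min_Perm by (meson order_trans)
  \<comment> \<open>Both infima are attained at \<open>P\<close>, so \<open>INF\<close> denotes a
    true minimum on each side.\<close>
  have "(INF Q\<in>Perm. ?f Q) = ?f P"
    using PPerm min_Perm by (intro cInf_eq_minimum) auto
  moreover have "(INF Q\<in>couplings a b. ?f Q) = ?f P"
    using PC min_C by (intro cInf_eq_minimum) auto
  moreover have "is_arg_min ?f (\<lambda>P. P \<in> couplings a b) P"
    using PC min_C by (simp add: is_arg_min_linorder)
  ultimately show ?thesis using P by auto
qed

end
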